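(* Let $(\Omega,(\mathcal F_k),\mathbb P)$ be a filtered probability space. Every martingale $F=(F_k)_{k=1}^n$ in $L^1$ admits a decomposition $F=G+B$, where $G=(G_k)_{k=1}^n$ and $B=(B_k)_{k=1}^n$ are martingales, so that the following holds: 1. (Integral bounds) $$\mathbb E\Big(\sum_{k=1}^n\mathbb E_{k-1}|\Delta G_k|^2\Big)^{1/2}+\mathbb E\Big(\sum_{k=1}^n|\Delta B_k|\Big)\le 8\,\mathbb E\Big(\sum_{k=1}^n|\Delta F_k|^2\Big)^{1/2}.$$ 2. (Previsible uniform estimates) $$|\Delta G_k|^2\le 2\sum_{m=1}^{k-1}|\Delta F_m|^2,\qquad k\le n.$$
   Context: Martingales are taken with respect to the filtration $(\mathcal F_k)$. $\mathbb E$ is expectation on $(\Omega,\mathbb P)$, $\mathbb E_k$ is conditional expectation with respect to $\mathcal F_k$, and $\Delta F_k=F_k-F_{k-1}$ (similarly for $G$ and $B$). For $k=1$, the filtration is understood to start with a $\sigma$-algebra $\mathcal F_0$, and $F_0=\mathbb E_0F_1$ (similarly $G_0$, $B_0$). An empty sum is $0$. *)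

theory Defs
  imports "HOL-Probability.Probability"
begin

text \<open>
  Conditional expectation of an integrable function with values in a finite-dimensional space,
  taken coordinatewise, so that real-valued and complex-valued functions are treated together.
\<close>

definition cond_expectation ::
    "'w measure \<Rightarrow> 'w measure \<Rightarrow> ('w \<Rightarrow> 'a::euclidean_space) \<Rightarrow> 'w \<Rightarrow> 'a" where
  "cond_expectation M N f x = (\<Sum>b\<in>Basis. real_cond_exp M N (\<lambda>y. f y \<bullet> b) x *\<^sub>R b)"

lemma cond_expectation_real: "cond_expectation M N (f :: 'w \<Rightarrow> real) = real_cond_exp M N f"
  by (rule ext) (simp add: cond_expectation_def)

text \<open>
  \<open>X\<close> is only looked at on the indices \<open>1, \<dots>, n\<close>; the filtration starts at index \<open>0\<close>.
\<close>

definition finite_martingale ::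
    "'w measure \<Rightarrow> (nat \<Rightarrow> 'w measure) \<Rightarrow> nat \<Rightarrow> (nat \<Rightarrow> 'w \<Rightarrow> 'a::euclidean_space) \<Rightarrow> bool" where
  "finite_martingale M Fil n X \<longleftrightarrow>
     (\<forall>k\<in>{1..n}. X k \<in> borel_measurable (Fil k) \<and> integrable M (X k)) \<and>
     (\<forall>k\<in>{2..n}. AE x in M. cond_expectation M (Fil (k - 1)) (X k) x = X (k - 1) x)"

text \<open>The increment at index \<open>1\<close> uses \<open>E(X\<^sub>1 | Fil\<^sub>0)\<close> as the initial value; \<open>X 0\<close> is ignored.\<close>

definition mart_diff ::
    "'w measure \<Rightarrow> (nat \<Rightarrow> 'w measure) \<Rightarrow> (nat \<Rightarrow> 'w \<Rightarrow> 'a::euclidean_space) \<Rightarrow> nat \<Rightarrow> 'w \<Rightarrow> 'a" where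
  "mart_diff M Fil X k x =
     X k x - (if k = 1 then cond_expectation M (Fil 0) (X 1) x else X (k - 1) x)"

text \<open>
  Square root on \<open>[0, \<infinity>]\<close>. It is needed because increments of \<open>L\<^sup>1\<close> martingales need not be
  square integrable, so that conditional second moments are \<open>[0, \<infinity>]\<close>-valued.
\<close>

definition ennsqrt :: "ennreal \<Rightarrow> ennreal" where
  "ennsqrt y = (if y = \<top> then \<top> else ennreal (sqrt (enn2real y)))"

end

theory Submission
  imports Defs
begin

text \<open>
  Write \<open>d\<^sub>k\<close> for the increments of \<open>F\<close> and \<open>S\<^sub>k\<close> for its square function up to time \<open>k\<close>. Let
  \<open>g\<^sub>k\<close> be \<open>d\<^sub>k\<close> where \<open>2 |d\<^sub>k|\<^sup>2 \<le> S\<^sub>k\<^sub>-\<^sub>1\<^sup>2\<close> and \<open>0\<close> elsewhere, \<open>b\<^sub>k = d\<^sub>k - g\<^sub>k\<close>, and let \<open>G\<close>, \<open>B\<close> have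
  the increments \<open>g\<^sub>k\<close>, \<open>b\<^sub>k\<close> minus their conditional means. The total variation of \<open>B\<close> costs at
  most \<open>2 E |b\<^sub>k|\<close> per step. For \<open>G\<close>, use \<open>\<surd>X \<le> S\<^sub>n + X / S\<^sub>n\<close> for the conditional square
  function; since \<open>1 / S\<^sub>n \<le> 1 / S\<^sub>k\<^sub>-\<^sub>1\<close> and \<open>1 / S\<^sub>k\<^sub>-\<^sub>1\<close> is previsible, the second term has expectation
  at most the sum of \<open>E (|g\<^sub>k|\<^sup>2 / S\<^sub>k\<^sub>-\<^sub>1)\<close>. Both contributions are controlled by a telescoping sum through
  the pointwise bound \<open>|g\<^sub>k|\<^sup>2 / S\<^sub>k\<^sub>-\<^sub>1 + 2 |b\<^sub>k| \<le> 7 (S\<^sub>k - S\<^sub>k\<^sub>-\<^sub>1)\<close>, and \<open>1 + 7 = 8\<close>.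
\<close>

section \<open>Conditional expectation of vector-valued functions: contraction and centering\<close>

context sigma_finite_subalgebra
begin

lemma borel_measurable_cond_expectation [measurable]:
  "cond_expectation M F f \<in> borel_measurable F"
  unfolding cond_expectation_def[abs_def] by measurable

lemma borel_measurable_cond_expectation2 [measurable]:
  "cond_expectation M F f \<in> borel_measurable M"
  unfolding cond_expectation_def[abs_def] by measurable

lemma cond_expectation_inner_Basis:
  "b \<in> Basis \<Longrightarrow> cond_expectation M F f x \<bullet> b = real_cond_exp M F (\<lambda>y. f y \<bullet> b) x"
  by (simp add: cond_expectation_def)

text \<open>As \<open>Basis\<close> is finite, the exceptional null sets of the coordinates combine
  into one.\<close>

lemma AE_eq_cond_expectationI:
  assumes "\<And>b. b \<in> Basis \<Longrightarrow> AE x in M. real_cond_exp M F (\<lambda>y. f y \<bullet> b) x = h x \<bullet> b"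
  shows "AE x in M. cond_expectation M F f x = h x"
proof -
  have "AE x in M. \<forall>b\<in>Basis. real_cond_exp M F (\<lambda>y. f y \<bullet> b) x = h x \<bullet> b"
    using assms by (subst AE_ball_countable) (auto intro: countable_finite)
  then show ?thesis
    by eventually_elim (auto intro: euclidean_eqI simp: cond_expectation_inner_Basis)
qed

lemma integrable_cond_expectation:
  "integrable M f \<Longrightarrow> integrable M (cond_expectation M F f)"
  unfolding cond_expectation_def[abs_def] 
  by (intro Bochner_Integration.integrable_sum Bochner_Integration.integrable_scaleR_left
      real_cond_exp_int integrable_inner_left)

lemma cond_expectation_F_meas:
  assumes "integrable M f" "f \<in> borel_measurable F"
  shows "AE x in M. cond_expectation M F f x = f x"
  using assms by (intro AE_eq_cond_expectationI real_cond_exp_F_meas) auto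

lemma cond_expectation_diff:
  assumes "integrable M f" "integrable M g"
  shows "AE x in M. cond_expectation M F (\<lambda>x. f x - g x) x
    = cond_expectation M F f x - cond_expectation M F g x"
proof (rule AE_eq_cond_expectationI)
  fix b :: 'b assume b: "b \<in> Basis"
  have "AE x in M. real_cond_exp M F (\<lambda>y. f y \<bullet> b - g y \<bullet> b) x
    = real_cond_exp M F (\<lambda>y. f y \<bullet> b) x - real_cond_exp M F (\<lambda>y. g y \<bullet> b) x"
    using assms by (intro real_cond_exp_diff) auto
  then show "AE x in M. real_cond_exp M F (\<lambda>y. (f y - g y) \<bullet> b) x
    = (cond_expectation M F f x - cond_expectation M F g x) \<bullet> b"
    by (simp add: inner_diff_left cond_expectation_inner_Basis b)
qed

text \<open>Subtracting the conditional mean is what turns truncated increments into martingale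
  differences.\<close>

lemma cond_expectation_centered:
  assumes "integrable M f"
  shows "AE x in M. cond_expectation M F (\<lambda>x. f x - cond_expectation M F f x) x = 0"
  using cond_expectation_diff[OF assms integrable_cond_expectation[OF assms]]
    cond_expectation_F_meas[OF integrable_cond_expectation[OF assms]
      borel_measurable_cond_expectation]
  by eventually_elim simp

text \<open>Dualizing against the \<open>F\<close>-measurable direction of the conditional expectation reduces this
  to the linearity of the scalar conditional expectation.\<close>

lemma norm_cond_expectation_le:
  assumes f: "integrable M f"
  shows "AE x in M. norm (cond_expectation M F f x) \<le> real_cond_exp M F (\<lambda>y. norm (f y)) x"
proof -
  define u where "u x = sgn (cond_expectation M F f x)" for x
  have u_F [measurable]: "u \<in> borel_measurable F"
    unfolding u_def[abs_def] sgn_div_norm by measurable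
  have u_M [measurable]: "u \<in> borel_measurable M"
    using measurable_from_subalg[OF subalg u_F] .
  have [measurable]: "f \<in> borel_measurable M" using f by auto
  have norm_u: "norm (u x) \<le> 1" for x
    by (simp add: u_def norm_sgn)
  have int: "integrable M (\<lambda>x. (u x \<bullet> b) * (f x \<bullet> b))" for b
  proof (rule Bochner_Integration.integrable_bound)
    show "integrable M (\<lambda>x. norm b * (norm (f x) * norm b))" using f by simp
    have "\<bar>u x \<bullet> b\<bar> * \<bar>f x \<bullet> b\<bar> \<le> norm b * (norm (f x) * norm b)" for x
      using Cauchy_Schwarz_ineq2[of "u x" b] Cauchy_Schwarz_ineq2[of "f x" b]
        mult_right_mono[OF norm_u[of x] norm_ge_zero[of b]]
      by (intro mult_mono) auto
    then show "AE x in M. norm ((u x \<bullet> b) * (f x \<bullet> b)) \<le> norm (norm b * (norm (f x) * norm b))"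
      by (simp add: abs_mult)
  qed measurable
  have "AE x in M. \<forall>b\<in>Basis. real_cond_exp M F (\<lambda>y. (u y \<bullet> b) * (f y \<bullet> b)) x
      = (u x \<bullet> b) * real_cond_exp M F (\<lambda>y. f y \<bullet> b) x"
    by (subst AE_ball_countable)
      (auto intro!: countable_finite real_cond_exp_mult int)
  moreover have "AE x in M. real_cond_exp M F (\<lambda>y. \<Sum>b\<in>Basis. (u y \<bullet> b) * (f y \<bullet> b)) x
      = (\<Sum>b\<in>Basis. real_cond_exp M F (\<lambda>y. (u y \<bullet> b) * (f y \<bullet> b)) x)"
    by (intro real_cond_exp_sum int)
  moreover have "AE x in M. real_cond_exp M F (\<lambda>y. \<Sum>b\<in>Basis. (u y \<bullet> b) * (f y \<bullet> b)) x
      \<le> real_cond_exp M F (\<lambda>y. norm (f y)) x"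
  proof (rule real_cond_exp_mono)
    show "AE x in M. (\<Sum>b\<in>Basis. (u x \<bullet> b) * (f x \<bullet> b)) \<le> norm (f x)"
    proof (rule AE_I2)
      fix x
      have "(\<Sum>b\<in>Basis. (u x \<bullet> b) * (f x \<bullet> b)) = u x \<bullet> f x"
        by (rule euclidean_inner[symmetric])
      also have "\<dots> \<le> norm (u x) * norm (f x)" by (rule norm_cauchy_schwarz)
      also have "\<dots> \<le> norm (f x)" using norm_u[of x] by (simp add: mult_left_le_one_le)
      finally show "(\<Sum>b\<in>Basis. (u x \<bullet> b) * (f x \<bullet> b)) \<le> norm (f x)" .
    qed
  qed (use f int in auto)
  ultimately show ?thesis
  proof eventually_elim
    case (elim x)
    have "norm (cond_expectation M F f x) = u x \<bullet> cond_expectation M F f x"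
      by (cases "cond_expectation M F f x = 0")
        (simp_all add: u_def sgn_div_norm power2_norm_eq_inner[symmetric] power2_eq_square)
    also have "\<dots> = (\<Sum>b\<in>Basis. (u x \<bullet> b) * real_cond_exp M F (\<lambda>y. f y \<bullet> b) x)"
      by (subst euclidean_inner) (simp add: cond_expectation_inner_Basis)
    finally show ?case using elim by simp
  qed
qed

text \<open>An \<open>F\<close>-measurable majorant is its own conditional expectation, so it
  survives conditioning. This is how a previsible bound on the truncated increments passes to their
  conditional means.\<close>

lemma norm_cond_expectation_le_bound:
  assumes "integrable M f" "integrable M r" "r \<in> borel_measurable F" "AE x in M. norm (f x) \<le> r x"
  shows "AE x in M. norm (cond_expectation M F f x) \<le> r x"
  using norm_cond_expectation_le[OF assms(1)] real_cond_exp_F_meas[OF assms(2,3)]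
    real_cond_exp_mono[OF assms(4) integrable_norm[OF assms(1)] assms(2)]
  by eventually_elim simp

text \<open>The factor 2 is the cost of the triangle inequality: the conditional mean has
  \<open>L^1\<close> norm at most that of \<open>f\<close>.\<close>

lemma nn_integral_norm_centered_le:
  assumes f: "integrable M f"
  shows "(\<integral>\<^sup>+ x. ennreal (norm (f x - cond_expectation M F f x)) \<partial>M)
    \<le> (\<integral>\<^sup>+ x. ennreal (2 * norm (f x)) \<partial>M)"
proof -
  note cf = integrable_cond_expectation[OF f]
  note cn = real_cond_exp_int[OF integrable_norm[OF f]]
  have "(\<integral>x. norm (f x - cond_expectation M F f x) \<partial>M)
      \<le> (\<integral>x. norm (f x) + real_cond_exp M F (\<lambda>y. norm (f y)) x \<partial>M)"
    proof (rule integral_mono_AE)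
    show "AE x in M. norm (f x - cond_expectation M F f x)
        \<le> norm (f x) + real_cond_exp M F (\<lambda>y. norm (f y)) x"
      using norm_cond_expectation_le[OF f]
      by eventually_elim (rule order_trans[OF norm_triangle_ineq4], simp)
  qed (use f cf cn in simp_all)
  also have "\<dots> = (\<integral>x. 2 * norm (f x) \<partial>M)"
    using f cn by simp
  finally show ?thesis
    using f cf by (simp add: nn_integral_eq_integral)
qed

text \<open>With an \<open>F\<close>-measurable weight the conditional mean is still an orthogonal
  projection, so centering cannot increase the weighted second moment. The majorant \<open>r\<close>
  makes every product in the expanded square integrable, although \<open>f\<close> itself is only
  assumed to be in \<open>L^1\<close>.\<close>

lemma nn_integral_weighted_centered_le:
  assumes f: "integrable M f"
    and w: "w \<in> borel_measurable F" "\<And>x. 0 \<le> w x"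
    and r: "r \<in> borel_measurable F" "integrable M r" "integrable M (\<lambda>x. w x * (r x)\<^sup>2)"
    and bound: "AE x in M. norm (f x) \<le> r x"
  shows "(\<integral>\<^sup>+ x. ennreal (w x * (norm (f x - cond_expectation M F f x))\<^sup>2) \<partial>M)
    \<le> (\<integral>\<^sup>+ x. ennreal (w x * (norm (f x))\<^sup>2) \<partial>M)"
proof -
  let ?e = "cond_expectation M F f"
  have [measurable]: "f \<in> borel_measurable M" using f by auto
  note [measurable] = w(1)
  have [measurable]: "w \<in> borel_measurable M" using measurable_from_subalg[OF subalg w(1)] .
  have e_bound: "AE x in M. norm (?e x) \<le> r x"
    by (rule norm_cond_expectation_le_bound[OF f r(2,1) bound])
  have dom: "integrable M (\<lambda>x. w x * p x)"
    if "AE x in M. \<bar>p x\<bar> \<le> (r x)\<^sup>2" and [measurable]: "p \<in> borel_measurable M" for p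
    using that(1) w(2)
    by (intro Bochner_Integration.integrable_bound[OF r(3)])
      (auto elim!: eventually_mono simp: abs_mult mult_left_mono)
  have prod_le: "\<bar>(y \<bullet> b) * (z \<bullet> b)\<bar> \<le> t\<^sup>2"
    if "norm y \<le> t" "norm z \<le> t" "b \<in> Basis" for y z b :: 'b and t :: real
    unfolding abs_mult power2_eq_square
    using that Basis_le_norm[OF that(3), of y] Basis_le_norm[OF that(3), of z] norm_ge_zero[of y]
    by (intro mult_mono) linarith+
  have int_fe: "integrable M (\<lambda>x. w x * ((f x \<bullet> b) * (?e x \<bullet> b)))" if b: "b \<in> Basis" for b
  proof (rule dom)
    show "AE x in M. \<bar>(f x \<bullet> b) * (?e x \<bullet> b)\<bar> \<le> (r x)\<^sup>2"
      using bound e_bound by eventually_elim (rule prod_le[OF _ _ b])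
  qed measurable
  have int_ee: "integrable M (\<lambda>x. w x * ((?e x \<bullet> b) * (?e x \<bullet> b)))" if b: "b \<in> Basis" for b
  proof (rule dom)
    show "AE x in M. \<bar>(?e x \<bullet> b) * (?e x \<bullet> b)\<bar> \<le> (r x)\<^sup>2"
      using e_bound by eventually_elim (rule prod_le[OF _ _ b])
  qed measurable
  \<comment> \<open>The factor \<open>w x * (?e x \<bullet> b)\<close> is
    \<open>F\<close>-measurable, so under the integral the coordinate of \<open>f\<close> may be
    replaced by its conditional expectation.\<close>
  have ortho_b: "(\<integral>x. w x * ((f x \<bullet> b) * (?e x \<bullet> b)) \<partial>M) = (\<integral>x. w x * ((?e x \<bullet> b) * (?e x \<bullet> b)) \<partial>M)"
    if b: "b \<in> Basis" for b
    using real_cond_exp_intg(2)[of "\<lambda>x. w x * (?e x \<bullet> b)" "\<lambda>x. f x \<bullet> b"] int_fe[OF b]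
    by (simp add: cond_expectation_inner_Basis[OF b, symmetric] ac_simps)
  have coord: "w x * (y \<bullet> z) = (\<Sum>b\<in>Basis. w x * ((y \<bullet> b) * (z \<bullet> b)))" for x and y z :: 'b
    unfolding euclidean_inner[of y z] by (rule sum_distrib_left)
  have inner_int: "integrable M (\<lambda>x. w x * (f x \<bullet> ?e x))" "integrable M (\<lambda>x. w x * (?e x \<bullet> ?e x))"
    unfolding coord by (intro Bochner_Integration.integrable_sum int_fe int_ee; assumption)+
  have ortho: "(\<integral>x. w x * (f x \<bullet> ?e x) \<partial>M) = (\<integral>x. w x * (?e x \<bullet> ?e x) \<partial>M)"
    unfolding coord by (simp add: Bochner_Integration.integral_sum int_fe int_ee ortho_b)
  have int_ff: "integrable M (\<lambda>x. w x * (norm (f x))\<^sup>2)"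
  proof (rule dom)
    show "AE x in M. \<bar>(norm (f x))\<^sup>2\<bar> \<le> (r x)\<^sup>2"
      using bound by eventually_elim (simp add: power_mono)
  qed measurable
  have expand: "w x * (norm (f x - ?e x))\<^sup>2
      = w x * (norm (f x))\<^sup>2 - 2 * (w x * (f x \<bullet> ?e x)) + w x * (?e x \<bullet> ?e x)" for x
    by (simp add: power2_norm_eq_inner inner_commute algebra_simps)
  have "(\<integral>x. w x * (norm (f x - ?e x))\<^sup>2 \<partial>M)
      = (\<integral>x. w x * (norm (f x))\<^sup>2 \<partial>M) - (\<integral>x. w x * (?e x \<bullet> ?e x) \<partial>M)"
    unfolding expand using int_ff inner_int by (simp add: ortho)
  also have "\<dots> \<le> (\<integral>x. w x * (norm (f x))\<^sup>2 \<partial>M)"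
    using w(2) by (simp add: integral_nonneg_AE)
  finally have "(\<integral>x. w x * (norm (f x - ?e x))\<^sup>2 \<partial>M) \<le> (\<integral>x. w x * (norm (f x))\<^sup>2 \<partial>M)" .
  moreover have "integrable M (\<lambda>x. w x * (norm (f x - ?e x))\<^sup>2)"
    unfolding expand using int_ff inner_int by simp
  ultimately show ?thesis
    using int_ff w(2) by (simp add: nn_integral_eq_integral ennreal_leI)
qed

end

section \<open>Elementary inequalities for real and extended nonnegative numbers\<close>

lemma inverse_times_square_le_sqrt_diff:
  fixes s d :: real
  assumes "0 \<le> s" "0 \<le> d" "2 * d\<^sup>2 \<le> s\<^sup>2"
  shows "inverse s * d\<^sup>2 \<le> 7 * (sqrt (s\<^sup>2 + d\<^sup>2) - s)"
proof (cases "s = 0")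
  case False
  define t where "t = sqrt (s\<^sup>2 + d\<^sup>2)"
  have t: "t\<^sup>2 = s\<^sup>2 + d\<^sup>2" "s \<le> t"
    using assms by (auto simp: t_def real_le_rsqrt)
  \<comment> \<open>A crude form of the hypothesis, chosen to give
    \<open>t\<^sup>2 \<le> 4 * s\<^sup>2\<close>. In \<open>d\<^sup>2 = (t - s) * (t + s)\<close>
    the second factor is then at most \<open>3 * s\<close>, well below the \<open>7 * s\<close>
    required.\<close>
  have "d\<^sup>2 \<le> 3 * s\<^sup>2"
    using assms(3) zero_le_power2[of s] by linarith
  then have "t \<le> 2 * s"
    using assms unfolding t_def by (intro real_le_lsqrt) (simp_all add: power_mult_distrib)
  then have "(t - s) * (t + s) \<le> (t - s) * (7 * s)"
    using t assms by (intro mult_left_mono) auto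
  moreover have "d\<^sup>2 = (t - s) * (t + s)"
    using t(1) by (simp add: power2_eq_square algebra_simps)
  ultimately show ?thesis
    unfolding t_def[symmetric] using False assms by (simp add: field_simps)
qed (use assms in simp)

text \<open>This case dictates the constant 7. The ratio of the two sides is extremal at the
  threshold \<open>s\<^sup>2 = 2 * d\<^sup>2\<close>, where the best constant is
  \<open>2 * (sqrt 3 + sqrt 2)\<close>, about 6.3; the proof uses 3/2 as a rational bound for
  \<open>sqrt 2\<close>.\<close>

lemma twice_le_sqrt_diff:
  fixes s d :: real
  assumes "0 \<le> s" "0 \<le> d" "s\<^sup>2 < 2 * d\<^sup>2"
  shows "2 * d \<le> 7 * (sqrt (s\<^sup>2 + d\<^sup>2) - s)"
proof -
  have "(3 / 2 * d)\<^sup>2 = 9 / 4 * d\<^sup>2"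
    by (simp add: power2_eq_square)
  then have "s\<^sup>2 \<le> (3 / 2 * d)\<^sup>2"
    using assms(3) zero_le_power2[of d] by linarith
  then have "s \<le> 3 / 2 * d"
    by (rule power2_le_imp_le) (simp add: assms)
  then have "s * d \<le> 3 / 2 * d * d"
    using assms by (intro mult_right_mono) simp_all
  moreover have "0 \<le> d * d" by simp
  \<comment> \<open>This is \<open>(2 / 7 * d + s)\<^sup>2 \<le> s\<^sup>2 + d\<^sup>2\<close> after
    expanding and multiplying by 49.\<close>
  ultimately have "28 * (s * d) \<le> 45 * (d * d)" by linarith
  then have "(2 / 7 * d + s)\<^sup>2 \<le> s\<^sup>2 + d\<^sup>2"
    by (simp add: power2_eq_square algebra_simps)
  then have "2 / 7 * d + s \<le> sqrt (s\<^sup>2 + d\<^sup>2)"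
    by (rule real_le_rsqrt)
  then show ?thesis by simp
qed

lemma inverse_ennreal_antimono:
  assumes "0 \<le> a" "a \<le> b"
  shows "inverse (ennreal b) \<le> inverse (ennreal a)"
proof (cases "a = 0")
  case False
  then show ?thesis using assms by (simp add: inverse_ennreal ennreal_leI le_imp_inverse_le)
qed simp

text \<open>At \<open>y = 0\<close> this relies on \<open>inverse 0 * X = \<top>\<close> for \<open>X \<noteq> 0\<close> in \<open>ennreal\<close>.\<close>

lemma ennsqrt_le:
  assumes "0 \<le> y"
  shows "ennsqrt X \<le> ennreal y + inverse (ennreal y) * X"
proof (cases "X = \<top> \<or> y = 0")
  case True
  then show ?thesis
  proof (cases "X = 0")
    case False
    then have "inverse (ennreal y) * X = \<top>"
      using True by (auto simp: ennreal_mult_eq_top_iff)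
    then show ?thesis by simp
  qed (simp add: ennsqrt_def)
next
  case False
  then obtain a where X: "X = ennreal a" "0 \<le> a" by (cases X) auto
  have y: "0 < y" using False assms by simp
  have "sqrt a \<le> y + inverse y * a"
  \<comment> \<open>One of the two terms suffices: if \<open>y < sqrt a\<close>, then
    \<open>sqrt a = a / sqrt a\<close> is at most \<open>a / y\<close>.\<close>
  proof (cases "sqrt a \<le> y")
    case False
    then have "sqrt a * y \<le> sqrt a * sqrt a" using X by (intro mult_left_mono) auto
    then have "sqrt a \<le> inverse y * a" using X y by (simp add: field_simps)
    then show ?thesis using y by simp
  qed (use X y in \<open>simp add: add_increasing2\<close>)
  then have "ennreal (sqrt a) \<le> ennreal (y + inverse y * a)" by (rule ennreal_leI)
  also have "\<dots> = ennreal y + inverse (ennreal y) * X"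
    using X y by (simp add: inverse_ennreal ennreal_mult)
  finally show ?thesis using X by (simp add: ennsqrt_def)
qed

section \<open>Finite martingales and their increments\<close>

lemma finite_martingale_diff:
  assumes sub: "\<And>k. sigma_finite_subalgebra M (Fil k)"
    and X: "finite_martingale M Fil n X" and Y: "finite_martingale M Fil n Y"
  shows "finite_martingale M Fil n (\<lambda>k x. X k x - Y k x)"
  unfolding finite_martingale_def
proof (intro conjI ballI)
  fix k assume "k \<in> {1..n}"
  then have "X k \<in> borel_measurable (Fil k)" "Y k \<in> borel_measurable (Fil k)"
    "integrable M (X k)" "integrable M (Y k)"
    using X Y by (auto simp: finite_martingale_def)
  then show "(\<lambda>x. X k x - Y k x) \<in> borel_measurable (Fil k)" "integrable M (\<lambda>x. X k x - Y k x)"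
    by simp_all
next
  fix k assume k: "k \<in> {2..n}"
  interpret sigma_finite_subalgebra M "Fil (k - 1)" by (rule sub)
  have "integrable M (X k)" "integrable M (Y k)"
    using X Y k by (auto simp: finite_martingale_def)
  note diff = cond_expectation_diff[OF this]
  have "AE x in M. cond_expectation M (Fil (k - 1)) (X k) x = X (k - 1) x"
    "AE x in M. cond_expectation M (Fil (k - 1)) (Y k) x = Y (k - 1) x"
    using X Y k by (auto simp: finite_martingale_def)
  with diff show "AE x in M. cond_expectation M (Fil (k - 1)) (\<lambda>x. X k x - Y k x) x
      = X (k - 1) x - Y (k - 1) x"
    by eventually_elim simp
qed


text \<open>Past index 1 each step adds the centered \<open>c k\<close> to a sum that is already
  measurable one step earlier. The empty sum at index 1 makes the martingale start at 0.\<close>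

lemma finite_martingale_sum:
  assumes sub: "\<And>k. sigma_finite_subalgebra M (Fil k)"
    and mono: "\<And>i j. i \<le> j \<Longrightarrow> subalgebra (Fil j) (Fil i)"
    and c: "\<And>k. k \<in> {2..n} \<Longrightarrow> c k \<in> borel_measurable (Fil k)"
      "\<And>k. k \<in> {2..n} \<Longrightarrow> integrable M (c k)"
      "\<And>k. k \<in> {2..n} \<Longrightarrow> AE x in M. cond_expectation M (Fil (k - 1)) (c k) x = 0"
  shows "finite_martingale M Fil n (\<lambda>k x. \<Sum>j=2..k. c j x)"
proof -
  have meas: "(\<lambda>x. \<Sum>j=2..k. c j x) \<in> borel_measurable (Fil k)" if "k \<le> n" for k
  proof (rule borel_measurable_sum)
    fix j assume "j \<in> {2..k}"
    then show "c j \<in> borel_measurable (Fil k)"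
      using that by (intro measurable_from_subalg[OF mono c(1)]) simp_all
  qed
  have int: "integrable M (\<lambda>x. \<Sum>j=2..k. c j x)" if "k \<le> n" for k
    using that by (intro Bochner_Integration.integrable_sum c(2)) simp
  show ?thesis
    unfolding finite_martingale_def
  proof (intro conjI ballI)
    fix k assume k: "k \<in> {2..n}"
    let ?G = "\<lambda>k x. \<Sum>j=2..k. c j x"
    interpret sigma_finite_subalgebra M "Fil (k - 1)" by (rule sub)
    have "(\<lambda>x. ?G k x - ?G (k - 1) x) = c k"
      using k by (cases k) auto
    moreover have "k \<le> n" "k - 1 \<le> n" using k by auto
    ultimately have "AE x in M. cond_expectation M (Fil (k - 1)) (c k) x
        = cond_expectation M (Fil (k - 1)) (?G k) x - cond_expectation M (Fil (k - 1)) (?G (k - 1)) x"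
      using cond_expectation_diff[OF int[of k] int[of "k - 1"]] by simp
    moreover have "AE x in M. cond_expectation M (Fil (k - 1)) (?G (k - 1)) x = ?G (k - 1) x"
      using k by (intro cond_expectation_F_meas int meas) auto
    moreover note c(3)[OF k]
    ultimately show "AE x in M. cond_expectation M (Fil (k - 1)) (?G k) x = ?G (k - 1) x"
      by eventually_elim simp
  qed (use meas int in auto)
qed

lemma mart_diff_finite_martingale:
  assumes sub: "\<And>k. sigma_finite_subalgebra M (Fil k)"
    and mono: "subalgebra (Fil k) (Fil (k - 1))"
    and X: "finite_martingale M Fil n X" and k: "k \<in> {1..n}"
  shows "mart_diff M Fil X k \<in> borel_measurable (Fil k)"
    and "integrable M (mart_diff M Fil X k)"
    and "AE x in M. cond_expectation M (Fil (k - 1)) (mart_diff M Fil X k) x = 0"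
proof -
  interpret sigma_finite_subalgebra M "Fil (k - 1)" by (rule sub)
  \<comment> \<open>\<open>Y\<close> treats the initial step and the later ones alike: in both cases
    it is \<open>Fil (k - 1)\<close>-measurable and almost everywhere the conditional expectation of
    \<open>X k\<close>.\<close>
  define Y where "Y = (if k = 1 then cond_expectation M (Fil 0) (X 1) else X (k - 1))"
  have diff: "mart_diff M Fil X k = (\<lambda>x. X k x - Y x)"
    by (auto simp: mart_diff_def Y_def)
  have X_k: "X k \<in> borel_measurable (Fil k)" "integrable M (X k)"
    using X k by (auto simp: finite_martingale_def)
  have Y: "Y \<in> borel_measurable (Fil (k - 1))" "integrable M Y"
    and EX: "AE x in M. cond_expectation M (Fil (k - 1)) (X k) x = Y x"
  proof -
    consider "k = 1" | "k \<in> {2..n}" "k - 1 \<in> {1..n}" using k by fastforce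
    then have "Y \<in> borel_measurable (Fil (k - 1)) \<and> integrable M Y \<and>
      (AE x in M. cond_expectation M (Fil (k - 1)) (X k) x = Y x)"
    proof cases
      case 1
      then show ?thesis
        using integrable_cond_expectation[OF X_k(2)] borel_measurable_cond_expectation[of "X k"]
        by (simp add: Y_def)
    next
      case 2
      then show ?thesis
        using X unfolding finite_martingale_def by (simp add: Y_def)
    qed
    then show "Y \<in> borel_measurable (Fil (k - 1))" "integrable M Y"
      "AE x in M. cond_expectation M (Fil (k - 1)) (X k) x = Y x" by simp_all
  qed
  have "Y \<in> borel_measurable (Fil k)"
    by (rule measurable_from_subalg[OF mono Y(1)])
  then show "mart_diff M Fil X k \<in> borel_measurable (Fil k)"
    unfolding diff using X_k by simp
  show "integrable M (mart_diff M Fil X k)"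
    unfolding diff using X_k Y by simp
  show "AE x in M. cond_expectation M (Fil (k - 1)) (mart_diff M Fil X k) x = 0"
    unfolding diff
    using cond_expectation_diff[OF X_k(2) Y(2)] cond_expectation_F_meas[OF Y(2,1)] EX
    by eventually_elim simp
qed

section \<open>Splitting the increments at a previsible threshold\<close>

theorem theorem4p4:
  fixes M :: "'w measure"
    and Fil :: "nat \<Rightarrow> 'w measure"
    and n :: nat
    and F :: "nat \<Rightarrow> 'w \<Rightarrow> 'a::{real_normed_field, euclidean_space}"
  assumes "prob_space M"
    and "filtration (space M) Fil"
    and "\<And>k. subalgebra M (Fil k)"
    and "1 \<le> n"
    and "finite_martingale M Fil n F"
  shows "\<exists>G B :: nat \<Rightarrow> 'w \<Rightarrow> 'a.
    finite_martingale M Fil n G \<and> finite_martingale M Fil n B \<and>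
    (\<forall>k\<in>{1..n}. \<forall>x\<in>space M. F k x = G k x + B k x) \<and>
    (\<integral>\<^sup>+ x. ennsqrt (\<Sum>k=1..n.
        nn_cond_exp M (Fil (k - 1)) (\<lambda>y. ennreal ((norm (mart_diff M Fil G k y))\<^sup>2)) x) \<partial>M)
      + (\<integral>\<^sup>+ x. ennreal (\<Sum>k=1..n. norm (mart_diff M Fil B k x)) \<partial>M)
      \<le> 8 * (\<integral>\<^sup>+ x. ennreal (sqrt (\<Sum>k=1..n. (norm (mart_diff M Fil F k x))\<^sup>2)) \<partial>M) \<and>
    (\<forall>k\<in>{1..n}. AE x in M.
      (norm (mart_diff M Fil G k x))\<^sup>2 \<le> 2 * (\<Sum>m=1..<k. (norm (mart_diff M Fil F m x))\<^sup>2))"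
proof -
  interpret prob_space M by fact
  have sub: "sigma_finite_subalgebra M (Fil k)" for k
    by (intro finite_measure_subalgebra_is_sigma_finite finite_measure_subalgebra.intro
        finite_measure_subalgebra_axioms.intro assms(3)) unfold_locales
  have mono: "subalgebra (Fil j) (Fil i)" if "i \<le> j" for i j
    using assms(2) that by (simp add: subalgebra_def filtration_def)
  note from_sub = measurable_from_subalg[OF assms(3)]

  \<comment> \<open>In the paper's notation, \<open>s k\<close> is the square function of \<open>F\<close> stopped at \<open>k - 1\<close>; with this shift it is
    previsible. As \<open>s 1 = 0\<close>, the whole first increment goes to \<open>B\<close>.\<close>
  define d where "d = mart_diff M Fil F"
  define s where "s k x = sqrt (\<Sum>m=1..<k. (norm (d m x))\<^sup>2)" for k x
  define g where "g k x = (if 2 * (norm (d k x))\<^sup>2 \<le> (s k x)\<^sup>2 then d k x else 0)" for k x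
  define b where "b k x = d k x - g k x" for k x
  define c where "c k x = g k x - cond_expectation M (Fil (k - 1)) (g k) x" for k x
  define G where "G k x = (\<Sum>j=2..k. c j x)" for k x
  \<comment> \<open>Defining \<open>B\<close> as a difference makes the decomposition hold at every
    point; that its increments are the centered \<open>b k\<close> is then an almost everywhere
    statement.\<close>
  define B where "B k x = F k x - G k x" for k x

  note d = mart_diff_finite_martingale[OF sub mono[OF diff_le_self] assms(5), folded d_def]
  have s_Suc: "s (Suc k) x = sqrt ((s k x)\<^sup>2 + (norm (d k x))\<^sup>2)" if "1 \<le> k" for k x
    using that by (simp add: s_def sum_nonneg)
  have s_mono: "s i x \<le> s j x" if "i \<le> j" for i j x
    using that unfolding s_def by (intro real_sqrt_le_mono sum_mono2) auto
  have s_nonneg: "0 \<le> s k x" for k x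
    by (simp add: s_def sum_nonneg)
  have s_meas: "s k \<in> borel_measurable (Fil (k - 1))" if "k \<le> Suc n" for k
  proof -
    have "d m \<in> borel_measurable (Fil (k - 1))" if "m \<in> {1..<k}" for m
      using that \<open>k \<le> Suc n\<close> by (intro measurable_from_subalg[OF mono d(1)]) auto
    then show ?thesis unfolding s_def[abs_def] by measurable
  qed
  \<comment> \<open>The Euclidean norm is at most the sum of the norms, so \<open>s k\<close> is
    integrable even when the increments are not square integrable.\<close>
  have s_int: "integrable M (s k)" if "k \<le> Suc n" for k
  proof (rule Bochner_Integration.integrable_bound)
    show "integrable M (\<lambda>x. \<Sum>m=1..<k. norm (d m x))"
      using that by (intro Bochner_Integration.integrable_sum integrable_norm d(2)) auto
    show "s k \<in> borel_measurable M" by (rule from_sub[OF s_meas[OF that]])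
    show "AE x in M. norm (s k x) \<le> norm (\<Sum>m=1..<k. norm (d m x))"
      using s_nonneg by (auto simp: s_def sum_nonneg intro!: L2_set_le_sum[unfolded L2_set_def])
  qed
  \<comment> \<open>The factor 2 in the threshold is chosen for this bound: \<open>g k\<close> and
    its conditional mean are each at most \<open>s k x / sqrt 2\<close>, so the squared norm of
    their difference is at most \<open>2 * (s k x)\<^sup>2\<close>.\<close>
  have g_bound: "norm (g k x) \<le> s k x / sqrt 2" for k x
  proof -
    have "2 * (norm (g k x))\<^sup>2 \<le> (s k x)\<^sup>2" by (simp add: g_def)
    then have "sqrt (2 * (norm (g k x))\<^sup>2) \<le> sqrt ((s k x)\<^sup>2)" by (rule real_sqrt_le_mono)
    then show ?thesis by (simp add: real_sqrt_mult s_nonneg field_simps)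
  qed
  have g_meas: "g k \<in> borel_measurable (Fil k)" if k: "k \<in> {1..n}" for k
  proof -
    have [measurable]: "s k \<in> borel_measurable (Fil k)"
      using k by (intro measurable_from_subalg[OF mono s_meas]) auto
    note [measurable] = d(1)[OF k]
    show ?thesis unfolding g_def[abs_def] by measurable
  qed
  have g_int: "integrable M (g k)" if k: "k \<in> {1..n}" for k
    using from_sub[OF g_meas[OF k]]
    by (intro Bochner_Integration.integrable_bound[OF d(2)[OF k]]) (auto simp: g_def)
  have b_int: "integrable M (b k)" if k: "k \<in> {1..n}" for k
    unfolding b_def[abs_def] using d(2)[OF k] g_int[OF k] by simp
  have c_props: "c k \<in> borel_measurable (Fil k)" "integrable M (c k)"
    "AE x in M. cond_expectation M (Fil (k - 1)) (c k) x = 0"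
    "AE x in M. (norm (c k x))\<^sup>2 \<le> 2 * (s k x)\<^sup>2"
    "AE x in M. d k x - c k x = b k x - cond_expectation M (Fil (k - 1)) (b k) x"
    if k: "k \<in> {1..n}" for k
  proof -
    interpret sigma_finite_subalgebra M "Fil (k - 1)" by (rule sub)
    let ?E = "cond_expectation M (Fil (k - 1))"
    have "?E (g k) \<in> borel_measurable (Fil k)"
      by (rule measurable_from_subalg[OF mono borel_measurable_cond_expectation]) simp
    then show "c k \<in> borel_measurable (Fil k)"
      unfolding c_def[abs_def] using g_meas[OF k] by simp
    show "integrable M (c k)"
      unfolding c_def[abs_def] using g_int[OF k] integrable_cond_expectation[OF g_int[OF k]] by simp
    show "AE x in M. ?E (c k) x = 0"
      unfolding c_def[abs_def] by (rule cond_expectation_centered[OF g_int[OF k]])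
    have "AE x in M. norm (?E (g k) x) \<le> s k x / sqrt 2"
      using k s_meas[of k] s_int[of k] g_bound
      by (intro norm_cond_expectation_le_bound g_int) auto
    then show "AE x in M. (norm (c k x))\<^sup>2 \<le> 2 * (s k x)\<^sup>2"
    proof eventually_elim
      case (elim x)
      have "norm (c k x) \<le> norm (g k x) + norm (?E (g k) x)"
        unfolding c_def by (rule norm_triangle_ineq4)
      also have "\<dots> \<le> 2 * (s k x / sqrt 2)"
        using elim g_bound[of k x] by linarith
      finally have "(norm (c k x))\<^sup>2 \<le> (2 * (s k x / sqrt 2))\<^sup>2"
        by (rule power_mono) simp
      then show ?case by (simp add: power_mult_distrib power_divide)
    qed
    \<comment> \<open>As \<open>d k\<close> has conditional mean 0, the conditional means of
      \<open>g k\<close> and \<open>b k\<close> are opposite.\<close>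
    show "AE x in M. d k x - c k x = b k x - ?E (b k) x"
      using cond_expectation_diff[OF d(2)[OF k] g_int[OF k]] d(3)[OF k]
      unfolding b_def[abs_def] c_def by eventually_elim simp
  qed

  have G: "finite_martingale M Fil n G"
    unfolding G_def[abs_def] using c_props by (intro finite_martingale_sum[OF sub mono]) auto
  have B: "finite_martingale M Fil n B"
    unfolding B_def[abs_def] by (rule finite_martingale_diff[OF sub assms(5) G])
  have dG: "mart_diff M Fil G k = c k" if k: "k \<in> {1..n}" for k
  proof (cases "k = 1")
    case True
    \<comment> \<open>Since \<open>s 1\<close> is an empty sum, the threshold admits
      \<open>d 1\<close> only where it vanishes.\<close>
    have "G 1 = (\<lambda>x. 0)" "g 1 = (\<lambda>x. 0)"
      by (auto simp: G_def[abs_def] g_def[abs_def] s_def)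
    then show ?thesis
      using True by (simp add: mart_diff_def[abs_def] c_def[abs_def])
  next
    case False
    have "G k x = c k x + G (k - 1) x" for x
      using False k unfolding G_def by (cases k) auto
    then show ?thesis using False by (auto simp: mart_diff_def)
  qed
  have dB: "AE x in M. mart_diff M Fil B k x = b k x - cond_expectation M (Fil (k - 1)) (b k) x"
    if k: "k \<in> {1..n}" for k
  proof (cases "k = 1")
    case True
    have B1: "B 1 = F 1" and b1: "b 1 = d 1"
      by (auto simp: B_def[abs_def] G_def b_def[abs_def] g_def s_def)
    have "mart_diff M Fil B 1 = d 1"
      unfolding d_def mart_diff_def[abs_def] B1 by simp
    \<comment> \<open>The first increment is already centered over \<open>Fil 0\<close>, so the
      conditional mean of \<open>b 1\<close> is 0 almost everywhere.\<close>
    then show ?thesis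
      using d(3)[OF k] True b1 by simp
  next
    case False
    have "mart_diff M Fil B k x = d k x - c k x" for x
      using False unfolding dG[OF k, symmetric] by (simp add: d_def mart_diff_def B_def)
    then show ?thesis using c_props(5)[OF k] by simp
  qed

  \<comment> \<open>Estimates for a single increment, weighted by the inverse square
    function\<close>
  define H where "H k = nn_cond_exp M (Fil (k - 1)) (\<lambda>y. ennreal ((norm (mart_diff M Fil G k y))\<^sup>2))"
    for k
  have H_meas: "H k \<in> borel_measurable M" for k
    unfolding H_def by measurable
  have s_meas_M: "s k \<in> borel_measurable M" if "k \<le> Suc n" for k
    using s_int[OF that] by simp
  have bound_G: "(\<integral>\<^sup>+ x. inverse (ennreal (s k x)) * H k x \<partial>M)
      \<le> (\<integral>\<^sup>+ x. ennreal (inverse (s k x) * (norm (g k x))\<^sup>2) \<partial>M)" if k: "k \<in> {1..n}" for k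
  proof -
    interpret sigma_finite_subalgebra M "Fil (k - 1)" by (rule sub)
    have [measurable]: "s k \<in> borel_measurable (Fil (k - 1))" using k by (intro s_meas) auto
    have [measurable]: "c k \<in> borel_measurable M" using c_props(2)[OF k] by simp
    \<comment> \<open>The weight is previsible, so integrating against it removes the conditional
      expectation in \<open>H k\<close>.\<close>
    have "(\<integral>\<^sup>+ x. inverse (ennreal (s k x)) * H k x \<partial>M)
        = (\<integral>\<^sup>+ x. inverse (ennreal (s k x)) * ennreal ((norm (c k x))\<^sup>2) \<partial>M)"
      unfolding H_def dG[OF k] by (rule nn_cond_exp_intg) measurable
    also have "\<dots> = (\<integral>\<^sup>+ x. ennreal (inverse (s k x) * (norm (c k x))\<^sup>2) \<partial>M)"
    proof (rule nn_integral_cong_AE)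
      \<comment> \<open>Where \<open>s k x = 0\<close> the two inverses differ, being
        \<open>\<top>\<close> in \<open>ennreal\<close> and 0 in the reals. There the uniform
        estimate forces \<open>c k x = 0\<close>, and both products are 0.\<close>
      show "AE x in M. inverse (ennreal (s k x)) * ennreal ((norm (c k x))\<^sup>2)
          = ennreal (inverse (s k x) * (norm (c k x))\<^sup>2)"
        using c_props(4)[OF k]
      proof eventually_elim
        case (elim x)
        show ?case
        proof (cases "s k x = 0")
          case False
          then have "0 < s k x" using s_nonneg[of k x] by simp
          then show ?thesis by (simp add: inverse_ennreal ennreal_mult)
        qed (use elim in simp)
      qed
    qed
    also have "\<dots> \<le> (\<integral>\<^sup>+ x. ennreal (inverse (s k x) * (norm (g k x))\<^sup>2) \<partial>M)"
      unfolding c_def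
    proof (rule nn_integral_weighted_centered_le[OF g_int[OF k], where r = "\<lambda>x. s k x / sqrt 2"])
      \<comment> \<open>The weighted square of the majorant is linear in \<open>s k\<close>, hence
        integrable; at \<open>s k x = 0\<close> the real convention \<open>inverse 0 = 0\<close>
        keeps the identity true.\<close>
      have "inverse (s k x) * (s k x / sqrt 2)\<^sup>2 = s k x / 2" for x
        by (cases "s k x = 0") (simp_all add: power_divide power2_eq_square)
      moreover have "integrable M (\<lambda>x. s k x / 2)"
        using k s_int[of k] by simp
      ultimately show "integrable M (\<lambda>x. inverse (s k x) * (s k x / sqrt 2)\<^sup>2)"
        by presburger
      show "(\<lambda>x. inverse (s k x)) \<in> borel_measurable (Fil (k - 1))"
        "(\<lambda>x. s k x / sqrt 2) \<in> borel_measurable (Fil (k - 1))"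
        by measurable
    qed (use k s_int[of k] s_nonneg g_bound in auto)
    finally show ?thesis .
  qed
  have bound_B: "(\<integral>\<^sup>+ x. ennreal (norm (mart_diff M Fil B k x)) \<partial>M)
      \<le> (\<integral>\<^sup>+ x. ennreal (2 * norm (b k x)) \<partial>M)" if k: "k \<in> {1..n}" for k
  proof -
    interpret sigma_finite_subalgebra M "Fil (k - 1)" by (rule sub)
    have "(\<integral>\<^sup>+ x. ennreal (norm (mart_diff M Fil B k x)) \<partial>M)
      = (\<integral>\<^sup>+ x. ennreal (norm (b k x - cond_expectation M (Fil (k - 1)) (b k) x)) \<partial>M)"
      using dB[OF k] by (intro nn_integral_cong_AE) (auto elim: eventually_mono)
    also have "\<dots> \<le> (\<integral>\<^sup>+ x. ennreal (2 * norm (b k x)) \<partial>M)"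
      by (rule nn_integral_norm_centered_le[OF b_int[OF k]])
    finally show ?thesis .
  qed
  \<comment> \<open>At each point one of \<open>g k x\<close> and \<open>b k x\<close> is 0, so each
    side of the threshold needs only one of the two scalar inequalities.\<close>
  have pointwise: "inverse (s k x) * (norm (g k x))\<^sup>2 + 2 * norm (b k x) \<le> 7 * (s (Suc k) x - s k x)"
    if "k \<in> {1..n}" for k x
    using that s_nonneg[of k x] inverse_times_square_le_sqrt_diff[of "s k x" "norm (d k x)"]
      twice_le_sqrt_diff[of "s k x" "norm (d k x)"]
    by (auto simp: s_Suc b_def g_def)
  have sum_le: "(\<integral>\<^sup>+ x. inverse (ennreal (s k x)) * H k x \<partial>M)
      + (\<integral>\<^sup>+ x. ennreal (norm (mart_diff M Fil B k x)) \<partial>M)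
      \<le> (\<integral>\<^sup>+ x. ennreal (7 * (s (Suc k) x - s k x)) \<partial>M)" if k: "k \<in> {1..n}" for k
  proof -
    have [measurable]: "s k \<in> borel_measurable M" "g k \<in> borel_measurable M" "b k \<in> borel_measurable M"
      using k s_meas_M[of k] g_int[OF k] b_int[OF k] by simp_all
    have "(\<integral>\<^sup>+ x. inverse (ennreal (s k x)) * H k x \<partial>M)
        + (\<integral>\<^sup>+ x. ennreal (norm (mart_diff M Fil B k x)) \<partial>M)
      \<le> (\<integral>\<^sup>+ x. ennreal (inverse (s k x) * (norm (g k x))\<^sup>2) \<partial>M)
        + (\<integral>\<^sup>+ x. ennreal (2 * norm (b k x)) \<partial>M)"
      by (intro add_mono bound_G bound_B k)
    also have "\<dots> = (\<integral>\<^sup>+ x. ennreal (inverse (s k x) * (norm (g k x))\<^sup>2) + ennreal (2 * norm (b k x)) \<partial>M)"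
      by (rule nn_integral_add[symmetric]) measurable
    also have "\<dots> \<le> (\<integral>\<^sup>+ x. ennreal (7 * (s (Suc k) x - s k x)) \<partial>M)"
      using pointwise[OF k] s_nonneg
      by (intro nn_integral_mono) (simp add: ennreal_plus[symmetric] ennreal_leI del: ennreal_plus)
    finally show ?thesis .
  qed

  \<comment> \<open>Summation over the increments and telescoping\<close>
  have "(\<integral>\<^sup>+ x. ennsqrt (\<Sum>k=1..n. H k x) \<partial>M)
      \<le> (\<integral>\<^sup>+ x. ennreal (s (Suc n) x) + (\<Sum>k=1..n. inverse (ennreal (s k x)) * H k x) \<partial>M)"
  proof (rule nn_integral_mono)
    fix x
    have "ennsqrt (\<Sum>k=1..n. H k x)
        \<le> ennreal (s (Suc n) x) + inverse (ennreal (s (Suc n) x)) * (\<Sum>k=1..n. H k x)"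
      by (rule ennsqrt_le[OF s_nonneg])
    \<comment> \<open>By the index shift \<open>s (Suc n)\<close> is the full square function, which
      is not previsible. Its inverse is replaced term by term by the larger inverse of
      \<open>s k\<close>, to which \<open>bound_G\<close> applies.\<close>
    also have "inverse (ennreal (s (Suc n) x)) * (\<Sum>k=1..n. H k x)
        \<le> (\<Sum>k=1..n. inverse (ennreal (s k x)) * H k x)"
      unfolding sum_distrib_left
      by (intro sum_mono mult_right_mono) (auto intro!: inverse_ennreal_antimono s_mono s_nonneg)
    finally show "ennsqrt (\<Sum>k=1..n. H k x)
        \<le> ennreal (s (Suc n) x) + (\<Sum>k=1..n. inverse (ennreal (s k x)) * H k x)"
      by simp
  qed
  also have "\<dots> = (\<integral>\<^sup>+ x. ennreal (s (Suc n) x) \<partial>M)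
      + (\<Sum>k=1..n. \<integral>\<^sup>+ x. inverse (ennreal (s k x)) * H k x \<partial>M)"
  proof -
    have meas: "(\<lambda>x. inverse (ennreal (s k x)) * H k x) \<in> borel_measurable M" if "k \<in> {1..n}" for k
    proof -
      have [measurable]: "s k \<in> borel_measurable M" using that by (intro s_meas_M) simp
      note [measurable] = H_meas
      show ?thesis by measurable
    qed
    have "(\<lambda>x. ennreal (s (Suc n) x)) \<in> borel_measurable M"
      using s_meas_M[of "Suc n"] by simp
    then show ?thesis
      by (simp only: nn_integral_add[OF _ borel_measurable_sum[OF meas]] nn_integral_sum[OF meas])
  qed
  finally have part_G: "(\<integral>\<^sup>+ x. ennsqrt (\<Sum>k=1..n. H k x) \<partial>M)
      \<le> (\<integral>\<^sup>+ x. ennreal (s (Suc n) x) \<partial>M)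
        + (\<Sum>k=1..n. \<integral>\<^sup>+ x. inverse (ennreal (s k x)) * H k x \<partial>M)" .
  have part_B: "(\<integral>\<^sup>+ x. ennreal (\<Sum>k=1..n. norm (mart_diff M Fil B k x)) \<partial>M)
      = (\<Sum>k=1..n. \<integral>\<^sup>+ x. ennreal (norm (mart_diff M Fil B k x)) \<partial>M)"
  proof -
    have "(\<lambda>x. ennreal (norm (mart_diff M Fil B k x))) \<in> borel_measurable M" if "k \<in> {1..n}" for k
      using mart_diff_finite_martingale(2)[OF sub mono[OF diff_le_self] B that] by simp
    then show ?thesis
      by (subst nn_integral_sum[symmetric]) simp_all
  qed
  have "(\<Sum>k=1..n. \<integral>\<^sup>+ x. ennreal (7 * (s (Suc k) x - s k x)) \<partial>M)
      = (\<integral>\<^sup>+ x. ennreal (\<Sum>k=1..n. 7 * (s (Suc k) x - s k x)) \<partial>M)"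
  proof -
    have "(\<lambda>x. ennreal (7 * (s (Suc k) x - s k x))) \<in> borel_measurable M" if "k \<in> {1..n}" for k
      using that s_meas_M[of k] s_meas_M[of "Suc k"] by simp
    then show ?thesis
      by (subst nn_integral_sum[symmetric]) (simp_all add: s_mono)
  qed
  also have "\<dots> = (\<integral>\<^sup>+ x. 7 * ennreal (s (Suc n) x) \<partial>M)"
  proof -
    \<comment> \<open>The lower end of the telescoping sum is \<open>s 1 = 0\<close>.\<close>
    have "(\<Sum>k=1..n. 7 * (s (Suc k) x - s k x)) = 7 * s (Suc n) x" for x
      unfolding sum_distrib_left[symmetric]
      using assms(4) sum_Suc_diff[of 1 n "\<lambda>k. s k x"] by (simp add: s_def[of "Suc 0"])
    then show ?thesis by (simp add: ennreal_mult s_nonneg)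
  qed
  also have "\<dots> = 7 * (\<integral>\<^sup>+ x. ennreal (s (Suc n) x) \<partial>M)"
    using s_meas_M[of "Suc n"] by (simp add: nn_integral_cmult)
  finally have telescope: "(\<Sum>k=1..n. \<integral>\<^sup>+ x. ennreal (7 * (s (Suc k) x - s k x)) \<partial>M)
      = 7 * (\<integral>\<^sup>+ x. ennreal (s (Suc n) x) \<partial>M)" .
  have "(\<integral>\<^sup>+ x. ennsqrt (\<Sum>k=1..n. H k x) \<partial>M)
      + (\<integral>\<^sup>+ x. ennreal (\<Sum>k=1..n. norm (mart_diff M Fil B k x)) \<partial>M)
    \<le> (\<integral>\<^sup>+ x. ennreal (s (Suc n) x) \<partial>M)
      + (\<Sum>k=1..n. (\<integral>\<^sup>+ x. inverse (ennreal (s k x)) * H k x \<partial>M)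
        + (\<integral>\<^sup>+ x. ennreal (norm (mart_diff M Fil B k x)) \<partial>M))"
    unfolding part_B sum.distrib add.assoc[symmetric] by (intro add_right_mono part_G)
  also have "\<dots> \<le> (\<integral>\<^sup>+ x. ennreal (s (Suc n) x) \<partial>M) + 7 * (\<integral>\<^sup>+ x. ennreal (s (Suc n) x) \<partial>M)"
    unfolding telescope[symmetric] by (intro add_left_mono sum_mono sum_le)
  also have "\<dots> = (1 + 7) * (\<integral>\<^sup>+ x. ennreal (s (Suc n) x) \<partial>M)"
    by (simp only: distrib_right mult_1_left)
  finally have main: "(\<integral>\<^sup>+ x. ennsqrt (\<Sum>k=1..n. H k x) \<partial>M)
      + (\<integral>\<^sup>+ x. ennreal (\<Sum>k=1..n. norm (mart_diff M Fil B k x)) \<partial>M)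
    \<le> 8 * (\<integral>\<^sup>+ x. ennreal (sqrt (\<Sum>k=1..n. (norm (d k x))\<^sup>2)) \<partial>M)"
    by (simp add: s_def atLeastLessThanSuc_atLeastAtMost)
  have uniform: "AE x in M. (norm (mart_diff M Fil G k x))\<^sup>2 \<le> 2 * (\<Sum>m=1..<k. (norm (d m x))\<^sup>2)"
    if k: "k \<in> {1..n}" for k
    using c_props(4)[OF k] by (simp add: dG[OF k] s_def sum_nonneg)
  show ?thesis
    using G B main uniform unfolding H_def d_def
    by (intro exI[of _ G] exI[of _ B]) (simp add: B_def)
qed

end
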